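(* Consider the semidiscrete scheme with the weight-adjusted mass matrix, i.e. with $\widetilde M_J := M\, M_{1/J}^{-1} M$ on each element $e\in\mathcal{E}$, consisting for every $e\in\mathcal{E}$ of $$\widetilde M_J \frac{d p}{dt} + S_x v_x + S_y v_y = -\sum_{g\in\mathcal{G}^e} (L^g)^T S_J^g W^g\,(v_n^* - v_n^-),$$ $$\widetilde M_J \frac{d v_x}{dt} - S_x^T p = -\sum_{g\in\mathcal{G}^e} (L^g)^T n_x^{-g} S_J^g W^g\, p^*,$$ $$\widetilde M_J \frac{d v_y}{dt} - S_y^T p = -\sum_{g\in\mathcal{G}^e} (L^g)^T n_y^{-g} S_J^g W^g\, p^*,$$ with all matrices and the numerical fluxes $p^*$, $v_n^*$ (with parameter $\alpha\ge 0$) as defined in the context. Assume that $M_{1/J}$ is symmetric positive definite for every $e\in\mathcal{E}$ and that (the diagonal entries of) $S_J^g$ are positive for every mortar element $g\in\mathcal{G}$. Let $$\mathcal{F} = \sum_{e\in\mathcal{E}} \mathcal{F}^e,\qquad \mathcal{F}^e = \tfrac12\left(p^T \widetilde M_J p + v_x^T \widetilde M_J v_x + v_y^T \widetilde M_J v_y\right).$$ Then every solution of this scheme satisfies the energy estimate $\mathcal{F}(t)\le \mathcal{F}(0)$ for all $t>0$.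
   Context: Model problem: the 2D acoustic wave equation $\partial_t p + \nabla\cdot v = 0$, $\partial_t v + \nabla p = 0$ on a domain $\Omega\subset\mathbb{R}^2$, with $v=(v_x,v_y)$ and either periodic boundary conditions or the boundary condition $n\cdot v=0$ on $\partial\Omega$. Mesh. $\Omega$ is partitioned into a finite set $\mathcal{E}$ of non-overlapping elements, each the image of a reference element $\hat e$ with coordinates $(r,s)$. The mortar $\Gamma=\bigcup_{e}\partial e$ is partitioned into a finite set $\mathcal{G}$ of non-overlapping one-dimensional mortar elements, each the image of a reference interval $\hat g$; each mortar element meets the boundary of at most two elements. $\mathcal{G}^e$ is the set of mortar elements connected to $e$. A mortar element connected to two elements is an interior mortar (with periodic boundary conditions all mortars are interior, opposite boundary parts being identified); one connected to a single element is a boundary mortar. Unknowns. For each $e$ there is a finite-dimensional space $V_h^e$ of functions on $\hat e$ with a basis $\{\phi_k\}$; $p, v_x, v_y$ denote the time-dependent coefficient vectors (in this basis) of the discrete pressure and velocity components on $e$. All vectors and matrices below depend on the element $e$ in general, although this is suppressed in the notation. Volume matrices. $W$ is the diagonal matrix of the strictly positive weights of a quadrature rule on $\hat e$; $J$ is the diagonal matrix of (possibly approximate) values of the Jacobian determinant at the quadrature nodes; $L$ evaluates a function of $V_h^e$ (given by its coefficients) at the quadrature nodes; $D_r$, $D_s$ evaluate its $r$- and $s$-derivatives at the quadrature nodes; $r_x,s_x,r_y,s_y$ are diagonal matrices of (possibly approximate) values of the metric derivatives $\partial r/\partial x,\partial s/\partial x,\partial r/\partial y,\partial s/\partial y$ at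 the quadrature nodes. Then $$M = L^T W L,\quad M_{1/J} = L^T W J^{-1} L,\quad S_x = L^T W J(r_x D_r + s_x D_s),\quad S_y = L^T W J (r_y D_r + s_y D_s).$$ $M$ is the reference mass matrix; it is symmetric positive definite. No exactness of the quadrature is assumed. Mortar matrices. For each $g\in\mathcal{G}$ a quadrature rule on $\hat g$ with positive weights is fixed; $W^g$ is the diagonal matrix of its weights and $S_J^g$ the diagonal matrix of values of the surface Jacobian determinant at its nodes. $W^g$ and $S_J^g$ are the same for the two elements sharing $g$. $L^g$ (depending on the element $e$) maps the coefficient vector of a function in $V_h^e$ to the values of its trace at the quadrature nodes of $g$. $n_x^{-g}$, $n_y^{-g}$ are the diagonal matrices of components, at the mortar quadrature nodes, of the unit normal to $g$ outward with respect to $e$; for the two elements sharing $g$ these normals are equal in magnitude and opposite in sign. Fluxes. As seen from element $e$ on $g\in\mathcal{G}^e$: $p^- = L^g p$ and $v_n^- = n_x^{-g}L^g v_x + n_y^{-g}L^g v_y$ are computed from $e$; on an interior mortar, $p^+$ and $v_n^+$ are the values at the same nodes computed from the other element connected to $g$ (with its own interpolation matrix), where $v_n^+$ uses the same normal $n^{-g}$ (outward to $e$). On a boundary mortar one sets $p^+ = p^-$ and $v_n^+ = -v_n^-$. The fluxes are, componentwise, $$p^* = \tfrac12(p^+ + p^-) - \tfrac{\alpha}{2}(v_n^+ - v_n^-),\qquad v_n^* = \tfrac12(v_n^+ + v_n^-) - \tfrac{\alpha}{2}(p^+ - p^-),$$ for a constant $\alpha\ge0$. *)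

theory Defs
  imports
    "HOL-Analysis.Derivative"
    "Jordan_Normal_Form.Gauss_Jordan_Elimination"
begin

unbundle no inner_syntax

text \<open>
  Vectors and matrices are those of Jordan_Normal_Form, since their sizes vary with the element
  and with the mortar element.  Indices of basis functions and quadrature nodes start at 0.
\<close>

subsection \<open>Linear algebra\<close>

text \<open>Meaningful for invertible matrices only.\<close>
definition minv :: "real mat \<Rightarrow> real mat" where
  "minv A = the (mat_inverse A)"

definition spd :: "nat \<Rightarrow> real mat \<Rightarrow> bool" where
  "spd n A \<longleftrightarrow> A \<in> carrier_mat n n \<and> transpose_mat A = A \<and>
     (\<forall>x \<in> carrier_vec n. x \<noteq> 0\<^sub>v n \<longrightarrow> x \<bullet> (A *\<^sub>v x) > 0)"


subsection \<open>Mesh, approximation spaces and quadrature\<close>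

text \<open>
  \<^item> A mortar element \<open>g\<close> is the image of \<open>ghat\<close> under \<open>mortar_map g\<close>.  Under periodic boundary
    conditions a mortar element has two copies in the plane on opposite parts of the boundary;
    \<open>shift e g\<close> is the translation that takes \<open>mortar_map g\<close> to the copy lying on the boundary
    of \<open>e\<close>.
  \<^item> \<open>conn e\<close> is the set of mortar elements connected to \<open>e\<close>.
  \<^item> \<open>jac\<close>, \<open>drdx\<close>, \<open>dsdx\<close>, \<open>drdy\<close>, \<open>dsdy\<close> are nodal values that may be approximate and hence
    are not tied to \<open>elem_map\<close>.  The nodal values \<open>sjac\<close> of the surface Jacobian are likewise
    left arbitrary, which includes the exact value (the speed of \<open>mortar_map g\<close>).
  \<^item> \<open>normal e g\<close> is the outward unit normal as a function on \<open>ghat\<close>.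
\<close>

record ('e, 'g) dg =
  Omega :: "(real \<times> real) set"
  elems :: "'e set"
  mortars :: "'g set"
  ehat :: "(real \<times> real) set"
  elem_map :: "'e \<Rightarrow> real \<times> real \<Rightarrow> real \<times> real"
  ghat :: "real set"
  mortar_map :: "'g \<Rightarrow> real \<Rightarrow> real \<times> real"
  shift :: "'e \<Rightarrow> 'g \<Rightarrow> real \<times> real"
  conn :: "'e \<Rightarrow> 'g set"
  normal :: "'e \<Rightarrow> 'g \<Rightarrow> real \<Rightarrow> real \<times> real"
  nb :: "'e \<Rightarrow> nat"
  basis :: "'e \<Rightarrow> nat \<Rightarrow> real \<times> real \<Rightarrow> real"
  nq :: "'e \<Rightarrow> nat"
  qnode :: "'e \<Rightarrow> nat \<Rightarrow> real \<times> real"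
  qweight :: "'e \<Rightarrow> nat \<Rightarrow> real"
  jac :: "'e \<Rightarrow> nat \<Rightarrow> real"
  drdx :: "'e \<Rightarrow> nat \<Rightarrow> real"
  dsdx :: "'e \<Rightarrow> nat \<Rightarrow> real"
  drdy :: "'e \<Rightarrow> nat \<Rightarrow> real"
  dsdy :: "'e \<Rightarrow> nat \<Rightarrow> real"
  nqg :: "'g \<Rightarrow> nat"
  gnode :: "'g \<Rightarrow> nat \<Rightarrow> real"
  gweight :: "'g \<Rightarrow> nat \<Rightarrow> real"
  sjac :: "'g \<Rightarrow> nat \<Rightarrow> real"

definition elem :: "('e, 'g) dg \<Rightarrow> 'e \<Rightarrow> (real \<times> real) set" where
  "elem D e = elem_map D e ` ehat D"

definition mortar_on :: "('e, 'g) dg \<Rightarrow> 'e \<Rightarrow> 'g \<Rightarrow> real \<Rightarrow> real \<times> real" where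
  "mortar_on D e g \<xi> = mortar_map D g \<xi> + shift D e g"

definition connected_elems :: "('e, 'g) dg \<Rightarrow> 'g \<Rightarrow> 'e set" where
  "connected_elems D g = {e \<in> elems D. g \<in> conn D e}"

definition interior_mortar :: "('e, 'g) dg \<Rightarrow> 'g \<Rightarrow> bool" where
  "interior_mortar D g \<longleftrightarrow> card (connected_elems D g) = 2"

definition boundary_mortar :: "('e, 'g) dg \<Rightarrow> 'g \<Rightarrow> bool" where
  "boundary_mortar D g \<longleftrightarrow> card (connected_elems D g) = 1"

text \<open>Meaningful for interior mortars \<open>g\<close> connected to \<open>e\<close>.\<close>
definition other_elem :: "('e, 'g) dg \<Rightarrow> 'e \<Rightarrow> 'g \<Rightarrow> 'e" where
  "other_elem D e g = (THE e'. e' \<in> connected_elems D g \<and> e' \<noteq> e)"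

definition valid_mesh :: "('e, 'g) dg \<Rightarrow> bool" where
  "valid_mesh D \<longleftrightarrow>
     open (Omega D) \<and> connected (Omega D) \<and> Omega D \<noteq> {} \<and>
     compact (ehat D) \<and> closure (interior (ehat D)) = ehat D \<and>
     finite (elems D) \<and>
     (\<forall>e \<in> elems D. continuous_on (ehat D) (elem_map D e) \<and> inj_on (elem_map D e) (ehat D)) \<and>
     (\<Union>e \<in> elems D. elem D e) = closure (Omega D) \<and>
     (\<forall>e \<in> elems D. \<forall>e' \<in> elems D. e \<noteq> e' \<longrightarrow> interior (elem D e) \<inter> interior (elem D e') = {}) \<and>
     finite (mortars D) \<and>
     (\<exists>a b. a < b \<and> ghat D = {a..b}) \<and>
     (\<forall>g \<in> mortars D. continuous_on (ghat D) (mortar_map D g) \<and>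
        inj_on (mortar_map D g) (interior (ghat D))) \<and>
     (\<forall>e \<in> elems D. conn D e \<subseteq> mortars D \<and>
        frontier (elem D e) = (\<Union>g \<in> conn D e. mortar_on D e g ` ghat D)) \<and>
     (\<forall>e \<in> elems D. \<forall>e' \<in> elems D. \<forall>g \<in> conn D e. \<forall>g' \<in> conn D e'. g \<noteq> g' \<longrightarrow>
        mortar_on D e g ` interior (ghat D) \<inter> mortar_on D e' g' ` interior (ghat D) = {}) \<and>
     (\<forall>g \<in> mortars D. interior_mortar D g \<or> boundary_mortar D g)"

text \<open>
  The two admissible boundary conditions.  In the wall case (\<open>n \<cdot> v = 0\<close>) there is no
  identification; in the periodic case two different copies of a mortar element both lie on the
  boundary of the domain.
\<close>

definition wall_bc :: "('e, 'g) dg \<Rightarrow> bool" where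
  "wall_bc D \<longleftrightarrow> (\<forall>e \<in> elems D. \<forall>g \<in> conn D e. shift D e g = 0)"

definition periodic_bc :: "('e, 'g) dg \<Rightarrow> bool" where
  "periodic_bc D \<longleftrightarrow>
     (\<forall>g \<in> mortars D. interior_mortar D g) \<and>
     (\<forall>g \<in> mortars D. \<forall>e \<in> connected_elems D g. \<forall>e' \<in> connected_elems D g.
        shift D e g \<noteq> shift D e' g \<longrightarrow> mortar_on D e g ` ghat D \<subseteq> frontier (Omega D))"

text \<open>
  Orthogonality and outwardness are required in the relative interior of the mortar element and
  extend to its end points, which may be corners of the element, by continuity.
\<close>

definition outward_unit_normal ::
    "('e, 'g) dg \<Rightarrow> 'e \<Rightarrow> 'g \<Rightarrow> (real \<Rightarrow> real \<times> real) \<Rightarrow> bool" where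
  "outward_unit_normal D e g \<nu> \<longleftrightarrow>
     continuous_on (ghat D) \<nu> \<and> (\<forall>\<xi> \<in> ghat D. norm (\<nu> \<xi>) = 1) \<and>
     (\<forall>\<xi> \<in> interior (ghat D).
        (\<forall>T. (mortar_map D g has_vector_derivative T) (at \<xi>) \<longrightarrow> inner (\<nu> \<xi>) T = 0) \<and>
        (\<forall>\<^sub>F t in at_right 0. mortar_on D e g \<xi> + t *\<^sub>R \<nu> \<xi> \<notin> elem D e \<and>
                              mortar_on D e g \<xi> - t *\<^sub>R \<nu> \<xi> \<in> elem D e))"

definition valid_normals :: "('e, 'g) dg \<Rightarrow> bool" where
  "valid_normals D \<longleftrightarrow>
     (\<forall>e \<in> elems D. \<forall>g \<in> conn D e. outward_unit_normal D e g (normal D e g)) \<and>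
     (\<forall>g \<in> mortars D. \<forall>e \<in> connected_elems D g. \<forall>e' \<in> connected_elems D g. e \<noteq> e' \<longrightarrow>
        (\<forall>\<xi> \<in> ghat D. normal D e' g \<xi> = - normal D e g \<xi>))"

text \<open>The space \<open>V\<^sub>h\<^sup>e\<close> is the span of \<open>basis e k\<close>, \<open>k < nb e\<close>, on \<open>ehat\<close>.\<close>

definition valid_spaces :: "('e, 'g) dg \<Rightarrow> bool" where
  "valid_spaces D \<longleftrightarrow>
     (\<forall>e \<in> elems D.
        (\<forall>k < nb D e. basis D e k differentiable_on ehat D) \<and>
        (\<forall>c. (\<forall>x \<in> ehat D. (\<Sum>k<nb D e. c k * basis D e k x) = 0) \<longrightarrow> (\<forall>k < nb D e. c k = 0)))"

definition valid_quadrature :: "('e, 'g) dg \<Rightarrow> bool" where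
  "valid_quadrature D \<longleftrightarrow>
     (\<forall>e \<in> elems D. \<forall>i < nq D e. qnode D e i \<in> ehat D \<and> qweight D e i > 0 \<and> jac D e i \<noteq> 0) \<and>
     (\<forall>g \<in> mortars D. \<forall>i < nqg D g. gnode D g i \<in> ghat D \<and> gweight D g i > 0)"


subsection \<open>Volume matrices\<close>

definition W_mat :: "('e, 'g) dg \<Rightarrow> 'e \<Rightarrow> real mat" where
  "W_mat D e = mat_diag (nq D e) (qweight D e)"

definition J_mat :: "('e, 'g) dg \<Rightarrow> 'e \<Rightarrow> real mat" where
  "J_mat D e = mat_diag (nq D e) (jac D e)"

definition L_mat :: "('e, 'g) dg \<Rightarrow> 'e \<Rightarrow> real mat" where
  "L_mat D e = mat (nq D e) (nb D e) (\<lambda>(i, k). basis D e k (qnode D e i))"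

text \<open>
  The derivative is taken within \<open>ehat\<close> because basis functions matter only there and quadrature
  nodes may lie on its boundary.
\<close>

definition D_r :: "('e, 'g) dg \<Rightarrow> 'e \<Rightarrow> real mat" where
  "D_r D e = mat (nq D e) (nb D e)
     (\<lambda>(i, k). frechet_derivative (basis D e k) (at (qnode D e i) within ehat D) (1, 0))"

definition D_s :: "('e, 'g) dg \<Rightarrow> 'e \<Rightarrow> real mat" where
  "D_s D e = mat (nq D e) (nb D e)
     (\<lambda>(i, k). frechet_derivative (basis D e k) (at (qnode D e i) within ehat D) (0, 1))"

definition M_mat :: "('e, 'g) dg \<Rightarrow> 'e \<Rightarrow> real mat" where
  "M_mat D e = transpose_mat (L_mat D e) * W_mat D e * L_mat D e"

definition M_invJ :: "('e, 'g) dg \<Rightarrow> 'e \<Rightarrow> real mat" where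
  "M_invJ D e = transpose_mat (L_mat D e) * W_mat D e * minv (J_mat D e) * L_mat D e"

definition S_x :: "('e, 'g) dg \<Rightarrow> 'e \<Rightarrow> real mat" where
  "S_x D e = transpose_mat (L_mat D e) * W_mat D e * J_mat D e *
     (mat_diag (nq D e) (drdx D e) * D_r D e + mat_diag (nq D e) (dsdx D e) * D_s D e)"

definition S_y :: "('e, 'g) dg \<Rightarrow> 'e \<Rightarrow> real mat" where
  "S_y D e = transpose_mat (L_mat D e) * W_mat D e * J_mat D e *
     (mat_diag (nq D e) (drdy D e) * D_r D e + mat_diag (nq D e) (dsdy D e) * D_s D e)"

text \<open>The weight-adjusted mass matrix.\<close>
definition M_wadj :: "('e, 'g) dg \<Rightarrow> 'e \<Rightarrow> real mat" where
  "M_wadj D e = M_mat D e * minv (M_invJ D e) * M_mat D e"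

text \<open>The standing assumptions on mesh, spaces, quadrature and reference mass matrix.\<close>

definition valid_dg :: "('e, 'g) dg \<Rightarrow> bool" where
  "valid_dg D \<longleftrightarrow>
     valid_mesh D \<and> (wall_bc D \<or> periodic_bc D) \<and> valid_normals D \<and> valid_spaces D \<and>
     valid_quadrature D \<and> (\<forall>e \<in> elems D. spd (nb D e) (M_mat D e))"


subsection \<open>Mortar matrices\<close>

definition Wg_mat :: "('e, 'g) dg \<Rightarrow> 'g \<Rightarrow> real mat" where
  "Wg_mat D g = mat_diag (nqg D g) (gweight D g)"

definition SJ_mat :: "('e, 'g) dg \<Rightarrow> 'g \<Rightarrow> real mat" where
  "SJ_mat D g = mat_diag (nqg D g) (sjac D g)"

text \<open>The trace at a mortar node is evaluated at the preimage of the node in \<open>ehat\<close>.\<close>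

definition Lg_mat :: "('e, 'g) dg \<Rightarrow> 'e \<Rightarrow> 'g \<Rightarrow> real mat" where
  "Lg_mat D e g = mat (nqg D g) (nb D e)
     (\<lambda>(i, k). basis D e k (inv_into (ehat D) (elem_map D e) (mortar_on D e g (gnode D g i))))"

definition nx_mat :: "('e, 'g) dg \<Rightarrow> 'e \<Rightarrow> 'g \<Rightarrow> real mat" where
  "nx_mat D e g = mat_diag (nqg D g) (\<lambda>i. fst (normal D e g (gnode D g i)))"

definition ny_mat :: "('e, 'g) dg \<Rightarrow> 'e \<Rightarrow> 'g \<Rightarrow> real mat" where
  "ny_mat D e g = mat_diag (nqg D g) (\<lambda>i. snd (normal D e g (gnode D g i)))"


subsection \<open>Fluxes\<close>

text \<open>
  Here \<open>p\<close>, \<open>vx\<close>, \<open>vy\<close> are the coefficient vectors of all elements at one instant, and \<open>e\<close> is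
  the element from which the mortar element \<open>g\<close> is seen.
\<close>

definition p_minus :: "('e, 'g) dg \<Rightarrow> ('e \<Rightarrow> real vec) \<Rightarrow> 'e \<Rightarrow> 'g \<Rightarrow> real vec" where
  "p_minus D p e g = Lg_mat D e g *\<^sub>v p e"

definition vn_minus ::
    "('e, 'g) dg \<Rightarrow> ('e \<Rightarrow> real vec) \<Rightarrow> ('e \<Rightarrow> real vec) \<Rightarrow> 'e \<Rightarrow> 'g \<Rightarrow> real vec" where
  "vn_minus D vx vy e g =
     (nx_mat D e g * Lg_mat D e g) *\<^sub>v vx e + (ny_mat D e g * Lg_mat D e g) *\<^sub>v vy e"

definition p_plus :: "('e, 'g) dg \<Rightarrow> ('e \<Rightarrow> real vec) \<Rightarrow> 'e \<Rightarrow> 'g \<Rightarrow> real vec" where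
  "p_plus D p e g =
     (if interior_mortar D g
      then let e' = other_elem D e g in Lg_mat D e' g *\<^sub>v p e'
      else p_minus D p e g)"

definition vn_plus ::
    "('e, 'g) dg \<Rightarrow> ('e \<Rightarrow> real vec) \<Rightarrow> ('e \<Rightarrow> real vec) \<Rightarrow> 'e \<Rightarrow> 'g \<Rightarrow> real vec" where
  "vn_plus D vx vy e g =
     (if interior_mortar D g
      then let e' = other_elem D e g in
        (nx_mat D e g * Lg_mat D e' g) *\<^sub>v vx e' + (ny_mat D e g * Lg_mat D e' g) *\<^sub>v vy e'
      else - vn_minus D vx vy e g)"

definition p_star ::
    "('e, 'g) dg \<Rightarrow> real \<Rightarrow> ('e \<Rightarrow> real vec) \<Rightarrow> ('e \<Rightarrow> real vec) \<Rightarrow> ('e \<Rightarrow> real vec) \<Rightarrow>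
     'e \<Rightarrow> 'g \<Rightarrow> real vec" where
  "p_star D \<alpha> p vx vy e g =
     (1/2) \<cdot>\<^sub>v (p_plus D p e g + p_minus D p e g)
     - (\<alpha>/2) \<cdot>\<^sub>v (vn_plus D vx vy e g - vn_minus D vx vy e g)"

definition vn_star ::
    "('e, 'g) dg \<Rightarrow> real \<Rightarrow> ('e \<Rightarrow> real vec) \<Rightarrow> ('e \<Rightarrow> real vec) \<Rightarrow> ('e \<Rightarrow> real vec) \<Rightarrow>
     'e \<Rightarrow> 'g \<Rightarrow> real vec" where
  "vn_star D \<alpha> p vx vy e g =
     (1/2) \<cdot>\<^sub>v (vn_plus D vx vy e g + vn_minus D vx vy e g)
     - (\<alpha>/2) \<cdot>\<^sub>v (p_plus D p e g - p_minus D p e g)"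


subsection \<open>The semidiscrete scheme and its energy\<close>

text \<open>Time derivative, one-sided at the initial time 0.\<close>

definition has_time_derivative :: "nat \<Rightarrow> (real \<Rightarrow> real vec) \<Rightarrow> real vec \<Rightarrow> real \<Rightarrow> bool" where
  "has_time_derivative n u u' t \<longleftrightarrow>
     u' \<in> carrier_vec n \<and>
     (\<forall>k < n. ((\<lambda>\<tau>. u \<tau> $ k) has_real_derivative (u' $ k)) (at t within {0..}))"

definition scheme_rhs ::
    "('e, 'g) dg \<Rightarrow> real \<Rightarrow> ('e \<Rightarrow> real vec) \<Rightarrow> ('e \<Rightarrow> real vec) \<Rightarrow> ('e \<Rightarrow> real vec) \<Rightarrow> 'e \<Rightarrow>
     real vec \<times> real vec \<times> real vec" where
  "scheme_rhs D \<alpha> p vx vy e =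
     (- finsum_vec TYPE(real) (nb D e)
          (\<lambda>g. (transpose_mat (Lg_mat D e g) * SJ_mat D g * Wg_mat D g)
                 *\<^sub>v (vn_star D \<alpha> p vx vy e g - vn_minus D vx vy e g)) (conn D e),
      - finsum_vec TYPE(real) (nb D e)
          (\<lambda>g. (transpose_mat (Lg_mat D e g) * nx_mat D e g * SJ_mat D g * Wg_mat D g)
                 *\<^sub>v p_star D \<alpha> p vx vy e g) (conn D e),
      - finsum_vec TYPE(real) (nb D e)
          (\<lambda>g. (transpose_mat (Lg_mat D e g) * ny_mat D e g * SJ_mat D g * Wg_mat D g)
                 *\<^sub>v p_star D \<alpha> p vx vy e g) (conn D e))"

definition scheme_lhs ::
    "('e, 'g) dg \<Rightarrow> real vec \<Rightarrow> real vec \<Rightarrow> real vec \<Rightarrow> real vec \<Rightarrow> real vec \<Rightarrow> real vec \<Rightarrow> 'e \<Rightarrow>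
     real vec \<times> real vec \<times> real vec" where
  "scheme_lhs D p' vx' vy' p vx vy e =
     (M_wadj D e *\<^sub>v p' + S_x D e *\<^sub>v vx + S_y D e *\<^sub>v vy,
      M_wadj D e *\<^sub>v vx' - transpose_mat (S_x D e) *\<^sub>v p,
      M_wadj D e *\<^sub>v vy' - transpose_mat (S_y D e) *\<^sub>v p)"

definition is_solution ::
    "('e, 'g) dg \<Rightarrow> real \<Rightarrow> ('e \<Rightarrow> real \<Rightarrow> real vec) \<Rightarrow> ('e \<Rightarrow> real \<Rightarrow> real vec) \<Rightarrow>
     ('e \<Rightarrow> real \<Rightarrow> real vec) \<Rightarrow> bool" where
  "is_solution D \<alpha> p vx vy \<longleftrightarrow>
     (\<forall>e \<in> elems D. \<forall>t \<ge> 0.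
        p e t \<in> carrier_vec (nb D e) \<and> vx e t \<in> carrier_vec (nb D e) \<and>
        vy e t \<in> carrier_vec (nb D e) \<and>
        (\<exists>p' vx' vy'.
           has_time_derivative (nb D e) (p e) p' t \<and>
           has_time_derivative (nb D e) (vx e) vx' t \<and>
           has_time_derivative (nb D e) (vy e) vy' t \<and>
           scheme_lhs D p' vx' vy' (p e t) (vx e t) (vy e t) e =
             scheme_rhs D \<alpha> (\<lambda>e. p e t) (\<lambda>e. vx e t) (\<lambda>e. vy e t) e))"

definition elem_energy ::
    "('e, 'g) dg \<Rightarrow> 'e \<Rightarrow> real vec \<Rightarrow> real vec \<Rightarrow> real vec \<Rightarrow> real" where
  "elem_energy D e p vx vy =
     1/2 * (p \<bullet> (M_wadj D e *\<^sub>v p) + vx \<bullet> (M_wadj D e *\<^sub>v vx) + vy \<bullet> (M_wadj D e *\<^sub>v vy))"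

definition energy ::
    "('e, 'g) dg \<Rightarrow> ('e \<Rightarrow> real \<Rightarrow> real vec) \<Rightarrow> ('e \<Rightarrow> real \<Rightarrow> real vec) \<Rightarrow>
     ('e \<Rightarrow> real \<Rightarrow> real vec) \<Rightarrow> real \<Rightarrow> real" where
  "energy D p vx vy t = (\<Sum>e \<in> elems D. elem_energy D e (p e t) (vx e t) (vy e t))"

end

theory Submission
  imports Defs "Jordan_Normal_Form.Determinant"
begin

text \<open>
  The energy is nonincreasing because its time derivative is minus a sum of squares.  Since the
  weight-adjusted mass matrix is symmetric, the derivative of \<open>u \<bullet> M u / 2\<close> is \<open>u \<bullet> M u'\<close>, so
  testing the three equations of an element with \<open>p\<close>, \<open>vx\<close> and \<open>vy\<close> gives the derivative of
  its energy.  The volume terms form a skew-symmetric operator and drop out whatever the accuracy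
  of the quadrature and of the metric terms (\<open>scheme_volume_cancellation\<close>).  Up to the sign, what
  is left is a sum over the mortar elements and their quadrature nodes, with positive weights, of
  \<open>p\<^sup>- (q\<^sup>* - q\<^sup>-) + q\<^sup>- p\<^sup>*\<close> (\<open>scheme_rhs_scalar_prod\<close>), where \<open>q\<close> is the velocity in the
  direction of the normal outward to the element under consideration.

  The sign of this term becomes visible when the sum over elements is rearranged into a sum over
  mortar elements (\<open>total_mortar_loss_nonneg\<close>).  On a boundary mortar the mirror
  state gives zero normal flux and pressure flux \<open>p + \<alpha> q\<close>, so the term equals \<open>\<alpha> q\<^sup>2\<close>.  On an interior mortar the
  neighbour's trace, seen with the opposite normal, is \<open>p\<^sub>2\<close> and \<open>- q\<^sub>2\<close>.  The central part of
  the flux contributes \<open>(p\<^sub>2 q\<^sub>1 - p\<^sub>1 q\<^sub>2) / 2\<close>, which changes sign when the two elements are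
  exchanged, and the penalty parts of the two sides add up to
  \<open>\<alpha> ((p\<^sub>1 - p\<^sub>2)\<^sup>2 + (q\<^sub>1 + q\<^sub>2)\<^sup>2) / 2\<close>.
  The terms that remain on the two kinds of mortar are nonnegative for \<open>\<alpha> \<ge> 0\<close>.
\<close>

section \<open>Symmetry of the weight-adjusted mass matrix\<close>

text \<open>A positive definite matrix has trivial kernel, so the inverse is a genuine one.\<close>

lemma spd_inverse:
  assumes "spd n A"
  shows "minv A \<in> carrier_mat n n" "A * minv A = 1\<^sub>m n" "minv A * A = 1\<^sub>m n"
proof -
  have A: "A \<in> carrier_mat n n"
    and pos: "\<And>x. x \<in> carrier_vec n \<Longrightarrow> x \<noteq> 0\<^sub>v n \<Longrightarrow> x \<bullet> (A *\<^sub>v x) > 0"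
    using assms by (auto simp: spd_def)
  have "det A \<noteq> 0"
  proof
    assume "det A = 0"
    then obtain v where "v \<in> carrier_vec n" "v \<noteq> 0\<^sub>v n" "A *\<^sub>v v = 0\<^sub>v n"
      using det_0_iff_vec_prod_zero_field[OF A] by auto
    with pos[of v] show False by simp
  qed
  then have "A \<in> Units (ring_mat TYPE(real) n ())"
    by (rule det_non_zero_imp_unit[OF A])
  then obtain B where "mat_inverse A = Some B"
    using mat_inverse(1)[OF A, where b = "()"] by (cases "mat_inverse A") auto
  then show "minv A \<in> carrier_mat n n" "A * minv A = 1\<^sub>m n" "minv A * A = 1\<^sub>m n"
    using mat_inverse(2)[OF A, of B] by (simp_all add: minv_def)
qed

text \<open>The transpose of the inverse is a left inverse of the same symmetric matrix.\<close>
lemma transpose_minv_spd: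
  assumes "spd n A"
  shows "transpose_mat (minv A) = minv A"
proof -
  let ?B = "minv A"
  let ?C = "transpose_mat ?B"
  have A: "A \<in> carrier_mat n n" and sym: "transpose_mat A = A"
    using assms by (auto simp: spd_def)
  note B = spd_inverse[OF assms]
  have C: "?C \<in> carrier_mat n n" using B(1) by simp
  have CA: "?C * A = 1\<^sub>m n"
    using transpose_mult[OF A B(1)] by (simp add: B(2) sym transpose_one)
  have "?C = ?C * (A * ?B)" using C by (simp add: B(2))
  also have "\<dots> = ?C * A * ?B" using A B(1) C by (simp add: assoc_mult_mat)
  also have "\<dots> = ?B" using B(1) by (simp add: CA)
  finally show ?thesis .
qed

lemma M_wadj_symmetric:
  assumes "spd (nb D e) (M_mat D e)" and "spd (nb D e) (M_invJ D e)"
  shows "M_wadj D e \<in> carrier_mat (nb D e) (nb D e)"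
    and "transpose_mat (M_wadj D e) = M_wadj D e"
proof -
  let ?n = "nb D e"
  let ?M = "M_mat D e" and ?B = "minv (M_invJ D e)"
  have M: "?M \<in> carrier_mat ?n ?n" and symM: "transpose_mat ?M = ?M"
    using assms(1) by (auto simp: spd_def)
  note B = spd_inverse(1)[OF assms(2)] and symB = transpose_minv_spd[OF assms(2)]
  show "M_wadj D e \<in> carrier_mat ?n ?n" using M B by (simp add: M_wadj_def)
  have MB: "?M * ?B \<in> carrier_mat ?n ?n" using M B by simp
  show "transpose_mat (M_wadj D e) = M_wadj D e"
    unfolding M_wadj_def transpose_mult[OF MB M] transpose_mult[OF M B] symM symB
    by (rule assoc_mult_mat[OF M B M, symmetric])
qed

section \<open>Pairings and quadratic forms\<close>

lemma scalar_prod_finsum_vec: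
  fixes u :: "real vec"
  assumes "finite F" and "u \<in> carrier_vec n" and "f \<in> F \<rightarrow> carrier_vec n"
  shows "u \<bullet> finsum_vec TYPE(real) n f F = (\<Sum>g\<in>F. u \<bullet> f g)"
proof -
  have "dim_vec (finsum_vec TYPE(real) n f F) = n"
    using finsum_vec_closed[OF assms(3)] by simp
  then have "u \<bullet> finsum_vec TYPE(real) n f F = (\<Sum>i = 0..<n. \<Sum>g\<in>F. u $ i * f g $ i)"
    by (simp add: scalar_prod_def index_finsum_vec[OF assms(1) _ assms(3)] sum_distrib_left)
  also have "\<dots> = (\<Sum>g\<in>F. \<Sum>i = 0..<n. u $ i * f g $ i)" by (rule sum.swap)
  also have "\<dots> = (\<Sum>g\<in>F. u \<bullet> f g)"
  proof (rule sum.cong[OF refl])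
    fix g assume "g \<in> F"
    then have "dim_vec (f g) = n" using funcset_mem[OF assms(3)] carrier_vecD by blast
    then show "(\<Sum>i = 0..<n. u $ i * f g $ i) = u \<bullet> f g" by (simp add: scalar_prod_def)
  qed
  finally show ?thesis .
qed

lemma mat_diag_mult_vec_index:
  fixes x :: "real vec"
  assumes "x \<in> carrier_vec m" "i < m"
  shows "(mat_diag m f *\<^sub>v x) $ i = f i * x $ i"
proof -
  have "(mat_diag m f *\<^sub>v x) $ i = (\<Sum>j = 0..<m. (if i = j then f j else 0) * x $ j)"
    using assms by (auto simp: mat_diag_def scalar_prod_def intro!: sum.cong)
  also have "\<dots> = (\<Sum>j = 0..<m. if i = j then f j * x $ j else 0)"
    by (rule sum.cong) auto
  finally show ?thesis using assms by simp
qed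

text \<open>
  Testing a lifted nodal function moves the interpolation matrix onto the test vector and leaves a
  quadrature sum on the mortar.
\<close>
lemma scalar_prod_weighted_lift:
  fixes u x :: "real vec"
  assumes L: "L \<in> carrier_mat m n" and u: "u \<in> carrier_vec n" and x: "x \<in> carrier_vec m"
  shows "u \<bullet> ((transpose_mat L * mat_diag m a * mat_diag m b) *\<^sub>v x)
       = (\<Sum>i\<in>{..<m}. b i * a i * ((L *\<^sub>v u) $ i * x $ i))"
proof -
  let ?d = "mat_diag m (\<lambda>i. a i * b i)"
  have "(transpose_mat L * mat_diag m a * mat_diag m b) *\<^sub>v x = transpose_mat L *\<^sub>v (?d *\<^sub>v x)"
    using L x by (simp add: assoc_mult_mat[of _ n m _ m _ m] assoc_mult_mat_vec[of _ n m _ m])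
  then have "u \<bullet> ((transpose_mat L * mat_diag m a * mat_diag m b) *\<^sub>v x)
      = (transpose_mat L *\<^sub>v (?d *\<^sub>v x)) \<bullet> u"
    using L by (simp add: comm_scalar_prod[OF u] mult_mat_vec_carrier[of _ n m]
        mult_mat_vec_carrier[OF mat_diag_dim x])
  also have "\<dots> = (?d *\<^sub>v x) \<bullet> (L *\<^sub>v u)"
    using L u x mult_mat_vec_carrier[OF mat_diag_dim x]
    by (intro transpose_vec_mult_scalar) auto
  also have "\<dots> = (\<Sum>i\<in>{..<m}. (?d *\<^sub>v x) $ i * (L *\<^sub>v u) $ i)"
    using L by (simp add: scalar_prod_def atLeast0LessThan)
  also have "\<dots> = (\<Sum>i\<in>{..<m}. b i * a i * ((L *\<^sub>v u) $ i * x $ i))"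
    using x by (intro sum.cong) (auto simp: mat_diag_mult_vec_index)
  finally show ?thesis .
qed

text \<open>
  Differentiating the expanded double sum yields \<open>u \<bullet> A u' + u' \<bullet> A u\<close>; symmetry makes the two
  terms equal.
\<close>
lemma symmetric_quadratic_form_derivative:
  assumes A: "A \<in> carrier_mat n n" and sym: "transpose_mat A = A"
    and u: "\<And>\<tau>. \<tau> \<ge> 0 \<Longrightarrow> u \<tau> \<in> carrier_vec n"
    and u': "has_time_derivative n u u' t" and t: "t \<ge> 0"
  shows "((\<lambda>\<tau>. u \<tau> \<bullet> (A *\<^sub>v u \<tau>)) has_real_derivative 2 * (u t \<bullet> (A *\<^sub>v u'))) (at t within {0..})"
proof -
  have u'c: "u' \<in> carrier_vec n"
    and du: "\<And>k. k < n \<Longrightarrow> ((\<lambda>\<tau>. u \<tau> $ k) has_real_derivative (u' $ k)) (at t within {0..})"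
    using u' by (auto simp: has_time_derivative_def)
  have expand: "x \<bullet> (A *\<^sub>v y) = (\<Sum>i\<in>{..<n}. \<Sum>j\<in>{..<n}. x $ i * (A $$ (i,j) * y $ j))"
    if "x \<in> carrier_vec n" "y \<in> carrier_vec n" for x y
    using that A by (auto simp: scalar_prod_def atLeast0LessThan sum_distrib_left intro!: sum.cong)
  have "((\<lambda>\<tau>. \<Sum>i\<in>{..<n}. \<Sum>j\<in>{..<n}. u \<tau> $ i * (A $$ (i,j) * u \<tau> $ j)) has_real_derivative
      (\<Sum>i\<in>{..<n}. \<Sum>j\<in>{..<n}. u t $ i * (A $$ (i,j) * u' $ j) + u' $ i * (A $$ (i,j) * u t $ j)))
      (at t within {0..})"
    by (intro DERIV_sum) (auto intro!: derivative_eq_intros du)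
  also have "(\<Sum>i\<in>{..<n}. \<Sum>j\<in>{..<n}. u t $ i * (A $$ (i,j) * u' $ j) + u' $ i * (A $$ (i,j) * u t $ j))
      = u t \<bullet> (A *\<^sub>v u') + u' \<bullet> (A *\<^sub>v u t)"
    using u[OF t] u'c by (simp add: expand sum.distrib)
  also have "u' \<bullet> (A *\<^sub>v u t) = u t \<bullet> (A *\<^sub>v u')"
    using transpose_vec_mult_scalar[OF A u[OF t] u'c] comm_scalar_prod[of "u t" n "A *\<^sub>v u'"]
      A u[OF t] u'c
    by (simp add: sym)
  finally have *: "((\<lambda>\<tau>. \<Sum>i\<in>{..<n}. \<Sum>j\<in>{..<n}. u \<tau> $ i * (A $$ (i,j) * u \<tau> $ j)) has_real_derivative
      2 * (u t \<bullet> (A *\<^sub>v u'))) (at t within {0..})" by simp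
  show ?thesis
    by (rule has_field_derivative_transform_within[OF *, of 1]) (use t u expand in auto)
qed

section \<open>Fluxes at the mortar nodes\<close>

lemma mortar_trace_carrier:
  "p_minus D p e g \<in> carrier_vec (nqg D g)"
  "vn_minus D vx vy e g \<in> carrier_vec (nqg D g)"
  "p_plus D p e g \<in> carrier_vec (nqg D g)"
  "vn_plus D vx vy e g \<in> carrier_vec (nqg D g)"
  "p_star D \<alpha> p vx vy e g \<in> carrier_vec (nqg D g)"
  "vn_star D \<alpha> p vx vy e g \<in> carrier_vec (nqg D g)"
proof -
  have rows: "dim_row (Lg_mat D e' g) = nqg D g" "dim_row (nx_mat D e g) = nqg D g"
    "dim_row (ny_mat D e g) = nqg D g" for e'
    by (simp_all add: Lg_mat_def nx_mat_def ny_mat_def mat_diag_def)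
  show pm: "p_minus D p e g \<in> carrier_vec (nqg D g)"
    unfolding p_minus_def by (rule carrier_vecI) (simp add: rows)
  show qm: "vn_minus D vx vy e g \<in> carrier_vec (nqg D g)"
    unfolding vn_minus_def by (rule carrier_vecI) (simp add: rows)
  show pp: "p_plus D p e g \<in> carrier_vec (nqg D g)"
    unfolding p_plus_def Let_def using pm by (auto intro!: carrier_vecI simp: rows)
  show qp: "vn_plus D vx vy e g \<in> carrier_vec (nqg D g)"
    unfolding vn_plus_def Let_def using qm by (auto intro!: carrier_vecI simp: rows)
  show "p_star D \<alpha> p vx vy e g \<in> carrier_vec (nqg D g)"
    unfolding p_star_def using pm qm pp qp by simp
  show "vn_star D \<alpha> p vx vy e g \<in> carrier_vec (nqg D g)"
    unfolding vn_star_def using pm qm pp qp by simp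
qed

lemma flux_nodal_values:
  assumes "i < nqg D g"
  shows "p_star D \<alpha> p vx vy e g $ i =
      (p_plus D p e g $ i + p_minus D p e g $ i) / 2
      - \<alpha> / 2 * (vn_plus D vx vy e g $ i - vn_minus D vx vy e g $ i)"
    and "vn_star D \<alpha> p vx vy e g $ i =
      (vn_plus D vx vy e g $ i + vn_minus D vx vy e g $ i) / 2
      - \<alpha> / 2 * (p_plus D p e g $ i - p_minus D p e g $ i)"
proof -
  have dims: "dim_vec (p_minus D p e g) = nqg D g" "dim_vec (vn_minus D vx vy e g) = nqg D g"
    "dim_vec (p_plus D p e g) = nqg D g" "dim_vec (vn_plus D vx vy e g) = nqg D g"
    by (rule carrier_vecD[OF mortar_trace_carrier(1)] carrier_vecD[OF mortar_trace_carrier(2)]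
        carrier_vecD[OF mortar_trace_carrier(3)] carrier_vecD[OF mortar_trace_carrier(4)])+
  show "p_star D \<alpha> p vx vy e g $ i =
      (p_plus D p e g $ i + p_minus D p e g $ i) / 2
      - \<alpha> / 2 * (vn_plus D vx vy e g $ i - vn_minus D vx vy e g $ i)"
    using assms by (simp add: p_star_def dims)
  show "vn_star D \<alpha> p vx vy e g $ i =
      (vn_plus D vx vy e g $ i + vn_minus D vx vy e g $ i) / 2
      - \<alpha> / 2 * (p_plus D p e g $ i - p_minus D p e g $ i)"
    using assms by (simp add: vn_star_def dims)
qed

section \<open>Energy balance of one element\<close>

text \<open>
  The rate at which element \<open>e\<close> loses energy through the mortar element \<open>g\<close>.  It may be negative
  for a single element, which then gains energy from its neighbour.
\<close>
definition mortar_energy_loss ::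
  "('e, 'g) dg \<Rightarrow> real \<Rightarrow> ('e \<Rightarrow> real vec) \<Rightarrow> ('e \<Rightarrow> real vec) \<Rightarrow> ('e \<Rightarrow> real vec) \<Rightarrow> 'e \<Rightarrow> 'g \<Rightarrow> real"
  where
  "mortar_energy_loss D \<alpha> p vx vy e g =
     (\<Sum>i\<in>{..<nqg D g}. gweight D g i * sjac D g i *
        (p_minus D p e g $ i * (vn_star D \<alpha> p vx vy e g $ i - vn_minus D vx vy e g $ i)
         + vn_minus D vx vy e g $ i * p_star D \<alpha> p vx vy e g $ i))"

text \<open>
  Both velocity equations carry the same pressure flux, and the normal components that weight it
  recombine \<open>vx\<close> and \<open>vy\<close> into the normal velocity.
\<close>
lemma scheme_rhs_scalar_prod:
  assumes fin: "finite (conn D e)"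
    and p: "p e \<in> carrier_vec (nb D e)"
    and vx: "vx e \<in> carrier_vec (nb D e)" and vy: "vy e \<in> carrier_vec (nb D e)"
    and R: "scheme_rhs D \<alpha> p vx vy e = (R1, R2, R3)"
  shows "p e \<bullet> R1 + vx e \<bullet> R2 + vy e \<bullet> R3 = - (\<Sum>g\<in>conn D e. mortar_energy_loss D \<alpha> p vx vy e g)"
proof -
  let ?n = "nb D e"
  let ?w = "\<lambda>g i. gweight D g i * sjac D g i"
  let ?L = "Lg_mat D e" and ?nx = "nx_mat D e" and ?ny = "ny_mat D e"
  let ?q = "vn_minus D vx vy e" and ?ps = "p_star D \<alpha> p vx vy e" and ?qs = "vn_star D \<alpha> p vx vy e"
  have L: "?L g \<in> carrier_mat (nqg D g) ?n" and nx: "?nx g \<in> carrier_mat (nqg D g) (nqg D g)"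
    and ny: "?ny g \<in> carrier_mat (nqg D g) (nqg D g)" for g
    by (auto simp: Lg_mat_def nx_mat_def ny_mat_def)
  have nxT: "transpose_mat (?nx g) = ?nx g" and nyT: "transpose_mat (?ny g) = ?ny g" for g
    by (auto simp: nx_mat_def ny_mat_def mat_diag_def)
  \<comment> \<open>\<open>K\<close> is the trace matrix in the pressure equation and the trace matrix premultiplied by a
    normal component in the velocity equations.\<close>
  have lift: "u \<bullet> (- finsum_vec TYPE(real) ?n
        (\<lambda>g. (transpose_mat (K g) * SJ_mat D g * Wg_mat D g) *\<^sub>v x g) (conn D e))
      = - (\<Sum>g\<in>conn D e. \<Sum>i\<in>{..<nqg D g}. ?w g i * ((K g *\<^sub>v u) $ i * x g $ i))"
    if K: "\<And>g. K g \<in> carrier_mat (nqg D g) ?n" and u: "u \<in> carrier_vec ?n"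
      and x: "\<And>g. x g \<in> carrier_vec (nqg D g)" for K u x
  proof -
    have summand: "(transpose_mat (K g) * SJ_mat D g * Wg_mat D g) *\<^sub>v x g \<in> carrier_vec ?n" for g
      by (rule carrier_vecI) (simp add: carrier_matD(2)[OF K])
    have "dim_vec u = dim_vec (finsum_vec TYPE(real) ?n
        (\<lambda>g. (transpose_mat (K g) * SJ_mat D g * Wg_mat D g) *\<^sub>v x g) (conn D e))"
      using carrier_vecD[OF u] carrier_vecD[OF finsum_vec_closed[where A = "conn D e", OF Pi_I[OF summand]]]
      by simp
    then show ?thesis
      using u summand fin scalar_prod_weighted_lift[OF K u x]
      by (simp add: scalar_prod_finsum_vec SJ_mat_def Wg_mat_def)
  qed
  have 1: "p e \<bullet> R1 = - (\<Sum>g\<in>conn D e. \<Sum>i\<in>{..<nqg D g}. ?w g i * (p_minus D p e g $ i * (?qs g - ?q g) $ i))"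
    using R lift[OF L p minus_carrier_vec[OF mortar_trace_carrier(6,2)]]
    by (auto simp: scheme_rhs_def p_minus_def)
  have K: "transpose_mat (?L g) * ?nx g = transpose_mat (?nx g * ?L g)"
    "transpose_mat (?L g) * ?ny g = transpose_mat (?ny g * ?L g)" for g
    using transpose_mult[OF nx L, of g] transpose_mult[OF ny L, of g] by (simp_all add: nxT nyT)
  have nxL: "?nx g * ?L g \<in> carrier_mat (nqg D g) ?n" and nyL: "?ny g * ?L g \<in> carrier_mat (nqg D g) ?n" for g
    using mult_carrier_mat[OF nx L] mult_carrier_mat[OF ny L] by auto
  have 2: "vx e \<bullet> R2 = - (\<Sum>g\<in>conn D e. \<Sum>i\<in>{..<nqg D g}. ?w g i * (((?nx g * ?L g) *\<^sub>v vx e) $ i * ?ps g $ i))"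
    using R lift[OF nxL vx mortar_trace_carrier(5)] by (auto simp: scheme_rhs_def K)
  have 3: "vy e \<bullet> R3 = - (\<Sum>g\<in>conn D e. \<Sum>i\<in>{..<nqg D g}. ?w g i * (((?ny g * ?L g) *\<^sub>v vy e) $ i * ?ps g $ i))"
    using R lift[OF nyL vy mortar_trace_carrier(5)] by (auto simp: scheme_rhs_def K)
  have q: "?q g $ i = ((?nx g * ?L g) *\<^sub>v vx e) $ i + ((?ny g * ?L g) *\<^sub>v vy e) $ i"
    if "i < nqg D g" for g i
    using that carrier_matD(1)[OF nyL, of g] by (simp add: vn_minus_def)
  have d: "(?qs g - ?q g) $ i = ?qs g $ i - ?q g $ i" if "i < nqg D g" for g i
    using that carrier_vecD[OF mortar_trace_carrier(2)[of D vx vy e g]] by simp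
  have "(\<Sum>g\<in>conn D e. mortar_energy_loss D \<alpha> p vx vy e g)
      = (\<Sum>g\<in>conn D e. (\<Sum>i\<in>{..<nqg D g}. ?w g i * (p_minus D p e g $ i * (?qs g - ?q g) $ i))
        + (\<Sum>i\<in>{..<nqg D g}. ?w g i * (((?nx g * ?L g) *\<^sub>v vx e) $ i * ?ps g $ i))
        + (\<Sum>i\<in>{..<nqg D g}. ?w g i * (((?ny g * ?L g) *\<^sub>v vy e) $ i * ?ps g $ i)))"
    unfolding mortar_energy_loss_def sum.distrib[symmetric]
    by (intro sum.cong refl) (simp add: q d algebra_simps del: index_minus_vec index_mult_mat_vec)
  then show ?thesis unfolding 1 2 3 by (simp add: sum.distrib)
qed

text \<open>
  The pressure equation contributes \<open>p \<bullet> S v\<close> and the velocity equation \<open>- v \<bullet> S\<^sup>T p\<close> for each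
  component of the velocity.
\<close>
lemma scheme_volume_cancellation:
  fixes p' :: "real vec"
  assumes A: "M_wadj D e \<in> carrier_mat (nb D e) (nb D e)"
    and c: "p' \<in> carrier_vec (nb D e)" "vx' \<in> carrier_vec (nb D e)" "vy' \<in> carrier_vec (nb D e)"
      "p \<in> carrier_vec (nb D e)" "vx \<in> carrier_vec (nb D e)" "vy \<in> carrier_vec (nb D e)"
    and l: "scheme_lhs D p' vx' vy' p vx vy e = (R1, R2, R3)"
  shows "p \<bullet> (M_wadj D e *\<^sub>v p') + vx \<bullet> (M_wadj D e *\<^sub>v vx') + vy \<bullet> (M_wadj D e *\<^sub>v vy')
       = p \<bullet> R1 + vx \<bullet> R2 + vy \<bullet> R3"
proof -
  let ?n = "nb D e"
  have S: "S_x D e \<in> carrier_mat ?n ?n" "S_y D e \<in> carrier_mat ?n ?n"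
    by (auto intro!: carrier_matI simp: S_x_def S_y_def L_mat_def D_r_def D_s_def mat_diag_def)
  have skew: "v \<bullet> (transpose_mat S *\<^sub>v p) = p \<bullet> (S *\<^sub>v v)"
    if "S \<in> carrier_mat ?n ?n" "v \<in> carrier_vec ?n" for S v
    using that c(4) transpose_vec_mult_scalar[OF that c(4)]
      comm_scalar_prod[of v ?n "transpose_mat S *\<^sub>v p"]
    by simp
  have "p \<bullet> R1 = p \<bullet> (M_wadj D e *\<^sub>v p') + p \<bullet> (S_x D e *\<^sub>v vx) + p \<bullet> (S_y D e *\<^sub>v vy)"
    "vx \<bullet> R2 = vx \<bullet> (M_wadj D e *\<^sub>v vx') - p \<bullet> (S_x D e *\<^sub>v vx)"
    "vy \<bullet> R3 = vy \<bullet> (M_wadj D e *\<^sub>v vy') - p \<bullet> (S_y D e *\<^sub>v vy)"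
    using l A c S
    by (auto simp: scheme_lhs_def scalar_prod_add_distrib[of _ ?n] scalar_prod_minus_distrib[of _ ?n]
        skew)
  then show ?thesis by simp
qed

section \<open>Summation over the mortar elements\<close>

text \<open>
  The mirror state \<open>p\<^sup>+ = p\<^sup>-\<close>, \<open>v\<^sup>+ = - v\<^sup>-\<close> turns the integrand into \<open>\<alpha>\<close> times the square
  of the normal velocity.
\<close>
lemma mortar_loss_boundary_nonneg:
  assumes "\<alpha> \<ge> 0" and "\<not> interior_mortar D g"
    and w: "\<And>i. i < nqg D g \<Longrightarrow> gweight D g i * sjac D g i \<ge> 0"
  shows "mortar_energy_loss D \<alpha> p vx vy e g \<ge> 0"
  unfolding mortar_energy_loss_def
proof (rule sum_nonneg)
  fix i assume "i \<in> {..<nqg D g}"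
  then have i: "i < nqg D g" by simp
  let ?p = "p_minus D p e g $ i" and ?q = "vn_minus D vx vy e g $ i"
  have "p_plus D p e g $ i = ?p" and "vn_plus D vx vy e g $ i = - ?q"
    using assms(2) i carrier_vecD[OF mortar_trace_carrier(2)[of D vx vy e g]]
    by (simp_all add: p_plus_def vn_plus_def)
  then have "?p * (vn_star D \<alpha> p vx vy e g $ i - ?q) + ?q * p_star D \<alpha> p vx vy e g $ i = \<alpha> * ?q\<^sup>2"
    by (simp add: flux_nodal_values[OF i] power2_eq_square algebra_simps)
  then show "0 \<le> gweight D g i * sjac D g i *
      (?p * (vn_star D \<alpha> p vx vy e g $ i - ?q) + ?q * p_star D \<alpha> p vx vy e g $ i)"
    using w[OF i] assms(1) by simp
qed

text \<open>
  The exterior state is built from the neighbour's coefficients with the normal of \<open>e\<close>, whereas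
  the interior state of the neighbour uses its own, opposite normal.
\<close>
lemma interior_plus_values:
  assumes g: "connected_elems D g = {e, e'}" "e \<noteq> e'" and i: "i < nqg D g"
    and n: "normal D e g (gnode D g i) = - normal D e' g (gnode D g i)"
    and c: "vx e' \<in> carrier_vec (nb D e')" "vy e' \<in> carrier_vec (nb D e')"
  shows "p_plus D p e g $ i = p_minus D p e' g $ i"
    and "vn_plus D vx vy e g $ i = - vn_minus D vx vy e' g $ i"
proof -
  have int: "interior_mortar D g" using g by (simp add: interior_mortar_def)
  have oth: "other_elem D e g = e'"
    unfolding other_elem_def g(1) using g(2) by (intro the_equality) auto
  show "p_plus D p e g $ i = p_minus D p e' g $ i"
    by (simp add: p_plus_def p_minus_def int oth)
  let ?L = "Lg_mat D e' g"
  have L: "?L \<in> carrier_mat (nqg D g) (nb D e')" by (simp add: Lg_mat_def)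
  have *: "((mat_diag (nqg D g) f * ?L) *\<^sub>v v) $ i = f i * (?L *\<^sub>v v) $ i"
    if "v \<in> carrier_vec (nb D e')" for f v
    unfolding assoc_mult_mat_vec[OF mat_diag_dim L that]
    by (rule mat_diag_mult_vec_index[OF mult_mat_vec_carrier[OF L that] i])
  have "dim_row (mat_diag (nqg D g) f * ?L) = nqg D g" for f :: "nat \<Rightarrow> real"
    by (simp add: mat_diag_def)
  then show "vn_plus D vx vy e g $ i = - vn_minus D vx vy e' g $ i"
    using i n c
    by (simp add: vn_plus_def vn_minus_def int oth nx_mat_def ny_mat_def *
        del: index_mult_mat_vec)
qed

text \<open>
  The losses seen from the two sides must be added: only then do the terms
  \<open>(p\<^sub>2 q\<^sub>1 - p\<^sub>1 q\<^sub>2) / 2\<close> of the central flux cancel and leave the jumps squared.  The normal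
  velocities are taken along opposite normals, hence their jump is a sum.
\<close>
lemma mortar_loss_interior_nonneg:
  assumes "\<alpha> \<ge> 0" and g: "connected_elems D g = {e, e'}" "e \<noteq> e'"
    and w: "\<And>i. i < nqg D g \<Longrightarrow> gweight D g i * sjac D g i \<ge> 0"
    and n: "\<And>i. i < nqg D g \<Longrightarrow> normal D e' g (gnode D g i) = - normal D e g (gnode D g i)"
    and c: "vx e \<in> carrier_vec (nb D e)" "vy e \<in> carrier_vec (nb D e)"
      "vx e' \<in> carrier_vec (nb D e')" "vy e' \<in> carrier_vec (nb D e')"
  shows "mortar_energy_loss D \<alpha> p vx vy e g + mortar_energy_loss D \<alpha> p vx vy e' g \<ge> 0"
  unfolding mortar_energy_loss_def sum.distrib[symmetric]
proof (rule sum_nonneg)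
  fix i assume "i \<in> {..<nqg D g}"
  then have i: "i < nqg D g" by simp
  have g': "connected_elems D g = {e', e}" "e' \<noteq> e" using g by auto
  have n': "normal D e g (gnode D g i) = - normal D e' g (gnode D g i)" using n[OF i] by simp
  let ?p1 = "p_minus D p e g $ i" and ?q1 = "vn_minus D vx vy e g $ i"
  let ?p2 = "p_minus D p e' g $ i" and ?q2 = "vn_minus D vx vy e' g $ i"
  let ?l = "\<lambda>e. p_minus D p e g $ i * (vn_star D \<alpha> p vx vy e g $ i - vn_minus D vx vy e g $ i)
         + vn_minus D vx vy e g $ i * p_star D \<alpha> p vx vy e g $ i"
  note plus = interior_plus_values[where vx = vx and vy = vy, OF g i n' c(3,4)] 
    interior_plus_values[where vx = vx and vy = vy, OF g' i n[OF i] c(1,2)]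
  have loss: "?l e + ?l e' = \<alpha> / 2 * ((?p1 - ?p2)\<^sup>2 + (?q1 + ?q2)\<^sup>2)"
    by (simp add: flux_nodal_values[OF i] plus power2_eq_square field_simps)
  have "?l e + ?l e' \<ge> 0" unfolding loss using assms(1) by simp
  then have "0 \<le> gweight D g i * sjac D g i * (?l e + ?l e')" using w[OF i] by simp
  then show "0 \<le> gweight D g i * sjac D g i * ?l e + gweight D g i * sjac D g i * ?l e'"
    by (simp only: distrib_left)
qed

lemma valid_dg_mesh:
  assumes "valid_dg D"
  shows "finite (elems D)" "finite (mortars D)" "\<And>e. e \<in> elems D \<Longrightarrow> conn D e \<subseteq> mortars D"
    and "\<And>e. e \<in> elems D \<Longrightarrow> finite (conn D e)"
proof -
  have "valid_mesh D" using assms by (simp add: valid_dg_def)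
  then show *: "finite (elems D)" "finite (mortars D)" "\<And>e. e \<in> elems D \<Longrightarrow> conn D e \<subseteq> mortars D"
    by (simp_all add: valid_mesh_def)
  show "\<And>e. e \<in> elems D \<Longrightarrow> finite (conn D e)"
    using finite_subset[OF *(3) *(2)] .
qed

text \<open>
  Exchanging the order of summation groups the contributions of the one or two elements that share
  a mortar element.
\<close>
lemma total_mortar_loss_nonneg:
  assumes v: "valid_dg D" and \<alpha>: "\<alpha> \<ge> 0"
    and sj: "\<forall>g \<in> mortars D. \<forall>i < nqg D g. sjac D g i > 0"
    and c: "\<And>e. e \<in> elems D \<Longrightarrow> vx e \<in> carrier_vec (nb D e)"
      "\<And>e. e \<in> elems D \<Longrightarrow> vy e \<in> carrier_vec (nb D e)"
  shows "(\<Sum>e\<in>elems D. \<Sum>g\<in>conn D e. mortar_energy_loss D \<alpha> p vx vy e g) \<ge> 0"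
proof -
  note fin = valid_dg_mesh(1,2)[OF v] and sub = valid_dg_mesh(3)[OF v]
  have quad: "gnode D g i \<in> ghat D" "gweight D g i > 0" if "g \<in> mortars D" "i < nqg D g" for g i
    using v that unfolding valid_dg_def valid_quadrature_def by blast+
  have nrm: "normal D e' g (gnode D g i) = - normal D e g (gnode D g i)"
    if "g \<in> mortars D" "e \<in> connected_elems D g" "e' \<in> connected_elems D g" "e \<noteq> e'" "i < nqg D g"
    for e e' g i
  proof -
    have "valid_normals D" using v by (simp add: valid_dg_def)
    then show ?thesis using that quad(1) unfolding valid_normals_def by blast
  qed
  have w: "gweight D g i * sjac D g i \<ge> 0" if "g \<in> mortars D" "i < nqg D g" for g i
    using sj quad(2)[OF that] that by (simp add: less_imp_le)
  let ?l = "mortar_energy_loss D \<alpha> p vx vy"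
  have "(\<Sum>e\<in>elems D. \<Sum>g\<in>conn D e. ?l e g)
      = (\<Sum>e\<in>elems D. \<Sum>g | g \<in> mortars D \<and> g \<in> conn D e. ?l e g)"
    using sub by (intro sum.cong refl arg_cong2[where f=sum]) auto
  also have "\<dots> = (\<Sum>g\<in>mortars D. \<Sum>e\<in>connected_elems D g. ?l e g)"
    unfolding connected_elems_def by (rule sum.swap_restrict[OF fin])
  also have "\<dots> \<ge> 0"
  proof (rule sum_nonneg)
    fix g assume g: "g \<in> mortars D"
    show "0 \<le> (\<Sum>e\<in>connected_elems D g. ?l e g)"
    proof (cases "interior_mortar D g")
      case True
      then obtain e e' where ee: "connected_elems D g = {e, e'}" "e \<noteq> e'"
        by (auto simp: interior_mortar_def card_2_iff)
      then have "e \<in> elems D" "e' \<in> elems D" by (auto simp: connected_elems_def)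
      then have "?l e g + ?l e' g \<ge> 0"
        using ee c by (intro mortar_loss_interior_nonneg \<alpha> w g nrm) auto
      then show ?thesis using ee by simp
    next
      case False
      then show ?thesis by (intro sum_nonneg mortar_loss_boundary_nonneg \<alpha> w g)
    qed
  qed
  finally show ?thesis .
qed

section \<open>Decay of the energy\<close>

theorem corollary3p1:
  fixes D :: "('e, 'g) dg" and \<alpha> :: real
    and p vx vy :: "'e \<Rightarrow> real \<Rightarrow> real vec"
  assumes "valid_dg D"
    and "\<alpha> \<ge> 0"
    and "\<forall>e \<in> elems D. spd (nb D e) (M_invJ D e)"
    and "\<forall>g \<in> mortars D. \<forall>i < nqg D g. sjac D g i > 0"
    and "is_solution D \<alpha> p vx vy"
  shows "\<forall>t > 0. energy D p vx vy t \<le> energy D p vx vy 0"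
proof (intro allI impI)
  fix T :: real assume T: "T > 0"
  note fin = valid_dg_mesh(4)[OF assms(1)]
  have "\<forall>e \<in> elems D. spd (nb D e) (M_mat D e)" using assms(1) by (simp add: valid_dg_def)
  then have A: "M_wadj D e \<in> carrier_mat (nb D e) (nb D e)"
    "transpose_mat (M_wadj D e) = M_wadj D e" if "e \<in> elems D" for e
    using M_wadj_symmetric[of D e] assms(3) that by simp_all
  have c: "p e t \<in> carrier_vec (nb D e)" "vx e t \<in> carrier_vec (nb D e)" "vy e t \<in> carrier_vec (nb D e)"
    if "e \<in> elems D" "t \<ge> 0" for e t
    using assms(5) that by (auto simp: is_solution_def)
  let ?loss = "\<lambda>t e. \<Sum>g\<in>conn D e. mortar_energy_loss D \<alpha> (\<lambda>e. p e t) (\<lambda>e. vx e t) (\<lambda>e. vy e t) e g"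
  have elem: "((\<lambda>t. elem_energy D e (p e t) (vx e t) (vy e t)) has_real_derivative - ?loss t e)
      (at t within {0..})" if e: "e \<in> elems D" and t: "t \<ge> 0" for e t
  proof -
    obtain p' vx' vy' where d: "has_time_derivative (nb D e) (p e) p' t"
      "has_time_derivative (nb D e) (vx e) vx' t" "has_time_derivative (nb D e) (vy e) vy' t"
      and eq: "scheme_lhs D p' vx' vy' (p e t) (vx e t) (vy e t) e =
             scheme_rhs D \<alpha> (\<lambda>e. p e t) (\<lambda>e. vx e t) (\<lambda>e. vy e t) e"
      using assms(5) e t unfolding is_solution_def by blast
    obtain R1 R2 R3 where R: "scheme_rhs D \<alpha> (\<lambda>e. p e t) (\<lambda>e. vx e t) (\<lambda>e. vy e t) e = (R1, R2, R3)"
      by (metis prod_cases3)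
    note quad = symmetric_quadratic_form_derivative[OF A[OF e] _ _ t]
    let ?A = "M_wadj D e"
    have deriv: "((\<lambda>t. elem_energy D e (p e t) (vx e t) (vy e t)) has_real_derivative
        1/2 * (2 * (p e t \<bullet> (?A *\<^sub>v p')) + 2 * (vx e t \<bullet> (?A *\<^sub>v vx')) + 2 * (vy e t \<bullet> (?A *\<^sub>v vy'))))
      (at t within {0..})"
      unfolding elem_energy_def
      by (intro DERIV_cmult DERIV_add quad d c e)
    have "p e t \<bullet> (?A *\<^sub>v p') + vx e t \<bullet> (?A *\<^sub>v vx') + vy e t \<bullet> (?A *\<^sub>v vy') = - ?loss t e"
      using scheme_volume_cancellation[OF A(1)[OF e] _ _ _ c[OF e t], of p' vx' vy' R1 R2 R3]
        scheme_rhs_scalar_prod[OF fin[OF e] _ _ _ R] c[OF e t] d R eq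
      by (simp add: has_time_derivative_def)
    moreover have "1/2 * (2 * a + 2 * b + 2 * c) = a + b + c" for a b c :: real by simp
    ultimately show ?thesis using deriv by metis
  qed
  have deriv: "(energy D p vx vy has_real_derivative - (\<Sum>e\<in>elems D. ?loss t e)) (at t within {0..})"
    if "t \<ge> 0" for t
    using DERIV_sum[of "elems D", OF elem[OF _ that]]
    by (simp add: energy_def[abs_def] sum_negf)
  show "energy D p vx vy T \<le> energy D p vx vy 0"
  proof (rule DERIV_nonpos_imp_decreasing_open[OF T[THEN less_imp_le]])
    fix t assume t: "0 < t" "t < T"
    then have "at t within {0..} = at t" by (intro at_within_interior) simp
    moreover have "- (\<Sum>e\<in>elems D. ?loss t e) \<le> 0"
      using total_mortar_loss_nonneg[OF assms(1,2,4), of "\<lambda>e. vx e t" "\<lambda>e. vy e t"] c t by simp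
    ultimately show "\<exists>y. (energy D p vx vy has_real_derivative y) (at t) \<and> y \<le> 0"
      using deriv[of t] t by auto
  next
    have "continuous_on {0..} (energy D p vx vy)"
      by (rule DERIV_continuous_on) (use deriv in auto)
    then show "continuous_on {0..T} (energy D p vx vy)" by (rule continuous_on_subset) auto
  qed
qed

end
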